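(* Suppose that $f_i,F_i$ $(i\in I)$, $g_j$ $(j\in J)$, $h_k$ $(k\in K)$ are all locally Lipschitz continuous, Gâteaux differentiable and regular in the sense of Clarke on $U$, and that $f_i^{\circ\circ}(y;d)$, $g_j^{\circ\circ}(y;d)$, $h_k^{\circ\circ}(y;d)$ and $F_i''(y;d)$ are all finite for every $y\in U$ and $d\in Z$. Let $x\in X$ and $(u,\lambda,\mu,\nu)\in\mathcal{F}_M$, and let $s=(s_1,\dots,s_p)$ with $s_i=\frac{f_i(u)}{F_i(u)}$. Assume that $f-s\ast F$ and $g$ are second-order convex at $u$ with respect to $U$ and $h$ is second-order infine at $u$ with respect to $U$, with common directions $v\in D(u)$ and $w\in Z$; that is, for every $y\in U$ there exist $v\in D(u)\setminus\{0\}$ and $w\in Z\setminus\{0\}$ such that for all $i\in I$, $j\in J$, $k\in K$, $$(f_i-s_iF_i)(y)-(f_i-s_iF_i)(u)\ge(f_i-s_iF_i)^\circ(u;w)+\tfrac12(f_i-s_iF_i)^{\circ\circ}(u;v),$$ $$g_j(y)-g_j(u)\ge g_j^\circ(u;w)+\tfrac12g_j^{\circ\circ}(u;v),\qquad h_k(y)-h_k(u)=h_k^\circ(u;w)+\tfrac12h_k^{\circ\circ}(u;v).$$ Then it is not the case that $\frac{f_i(x)}{F_i(x)}\le\frac{f_i(u)}{F_i(u)}$ for all $i\in I$ with strict inequality for at least one $i\in I$.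
   Context: Setting. $Z$ is a real reflexive Banach space with dual $Z^*$ and pairing $\langle\cdot,\cdot\rangle$; $U\subseteq Z$ is nonempty and open; $f,F:Z\to\mathbb{R}^p$, $g:Z\to\mathbb{R}^m$, $h:Z\to\mathbb{R}^l$ have components $f_i,F_i$ ($i\in I=\{1,\dots,p\}$), $g_j$ ($j\in J=\{1,\dots,m\}$), $h_k$ ($k\in K=\{1,\dots,l\}$), and $F_i(x)>0$ for all $x\in U$, $i\in I$. NMFP is the problem of minimizing $\frac{f}{F}=(\frac{f_1}{F_1},\dots,\frac{f_p}{F_p})^\top$ over $X=\{x\in U: g_j(x)\le0\ \forall j\in J,\ h_k(x)=0\ \forall k\in K\}$. $f-s\ast F$ has components $f_i-s_iF_i$. $\mathbb{R}^n_+$ and $\mathbb{R}^n_{++}$ are the nonnegative and positive orthants. Derivatives. For $\vartheta:U\to\mathbb{R}$, $x\in U$, $v\in Z$: $\vartheta'(x;v)=\lim_{t\to0^+}\frac{\vartheta(x+tv)-\vartheta(x)}{t}$; $\vartheta$ is Gâteaux differentiable at $x$ with Gâteaux derivative $\vartheta'_G(x)\in Z^*$ if $\vartheta'(x;v)$ exists and equals $\langle\vartheta'_G(x),v\rangle$ for all $v\in Z$; $\vartheta^{\circ}(x;v)=\limsup_{y\to x,\,t\to0^+}\frac{\vartheta(y+tv)-\vartheta(y)}{t}$ (Clarke); $\vartheta$ is regular in the sense of Clarke at $x$ if $\vartheta'(x;v)$ exists and equals $\vartheta^\circ(x;v)$ for all $v\in Z$; $\vartheta''(x;v)=\lim_{t\to0^+}\frac{\vartheta(x+tv)-\vartheta(x)-t\vartheta'(x;v)}{\frac12t^2}$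 if the limit exists; $\vartheta^{\circ\circ}(x;v)=\limsup_{t\to0^+}\frac{\vartheta(x+tv)-\vartheta(x)-t\vartheta^\circ(x;v)}{\frac12t^2}$ (Páles–Zeidan). Gâteaux derivatives of $f_i,F_i,g_j,h_k$ are written $f'_{i,G},F'_{i,G},g'_{j,G},h'_{k,G}$. Cones. For $u\in U$: $T(X,u)=\{d\in Z:\exists\,t_k\to0^+,\ d_k\to d,\ u+t_kd_k\in X\ \forall k\}$; $J(u)=\{j\in J:g_j(u)=0\}$; $$C(Q,u)=\{d\in Z:\ (\tfrac{f_i}{F_i})^\circ(u;d)\le0\ \forall i\in I,\ g_j^\circ(u;d)\le0\ \forall j\in J(u),\ h_k^\circ(u;d)=0\ \forall k\in K\}$$ ($Q$ is only part of the notation); $D(u)=T(X,u)\cap C(Q,u)$. Dual problem. The Mond–Weir-type second-order dual problem (MWSD) is to maximize $(\frac fF)(u)$ over the set $\mathcal{F}_M$ of all $(u,\lambda,\mu,\nu)\in U\times\mathbb{R}^p_{++}\times\mathbb{R}^m_+\times\mathbb{R}^l$ such that, with $s_i=\frac{f_i(u)}{F_i(u)}$, $$\sum_{i=1}^p\lambda_i(f'_{i,G}(u)-s_iF'_{i,G}(u))+\sum_{j=1}^m\mu_jg'_{j,G}(u)+\sum_{k=1}^l\nu_kh'_{k,G}(u)=0,$$ $$\sum_{i=1}^p\lambda_i(f_i^{\circ\circ}(u;v)-s_iF_i''(u;v))+\sum_{j=1}^m\mu_jg_j^{\circ\circ}(u;v)+\sum_{k=1}^l\nu_kh_k^{\circ\circ}(u;v)\ge0\quad\forall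 v\in D(u),$$ $$\sum_{j=1}^m\mu_jg_j(u)+\sum_{k=1}^l\nu_kh_k(u)\ge0,\qquad\sum_{i=1}^p\lambda_i=1.$$ *)

theory Defs
  imports "HOL-Analysis.Analysis"
begin

text \<open>The dual of a real normed space \<open>'z\<close> is \<open>'z \<Rightarrow>\<^sub>L real\<close>. Reflexivity is surjectivity of
  the canonical embedding into the bidual.\<close>

definition reflexive_space :: "'z::real_normed_vector itself \<Rightarrow> bool" where
  "reflexive_space _ \<longleftrightarrow>
     (\<forall>\<Phi> :: ('z \<Rightarrow>\<^sub>L real) \<Rightarrow>\<^sub>L real. \<exists>z::'z. \<forall>\<phi>. blinfun_apply \<Phi> \<phi> = blinfun_apply \<phi> z)"

definition locally_lipschitz_on :: "'z::metric_space set \<Rightarrow> ('z \<Rightarrow> real) \<Rightarrow> bool" where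
  "locally_lipschitz_on U \<theta> \<longleftrightarrow>
     (\<forall>x\<in>U. \<exists>e>0. \<exists>L. L-lipschitz_on (ball x e \<inter> U) \<theta>)"


text \<open>All functions are total on \<open>'z\<close>; at a point of an open set \<open>U\<close> the notions below depend only
  on the restriction to \<open>U\<close>. The two upper limits are taken in the extended reals, so that their
  finiteness is a genuine condition.\<close>

definition has_dir_deriv :: "('z::real_normed_vector \<Rightarrow> real) \<Rightarrow> 'z \<Rightarrow> 'z \<Rightarrow> real \<Rightarrow> bool" where
  "has_dir_deriv \<theta> x v d \<longleftrightarrow>
     ((\<lambda>t. (\<theta> (x + t *\<^sub>R v) - \<theta> x) / t) \<longlongrightarrow> d) (at_right 0)"

definition dir_deriv :: "('z::real_normed_vector \<Rightarrow> real) \<Rightarrow> 'z \<Rightarrow> 'z \<Rightarrow> real" where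
  "dir_deriv \<theta> x v = (THE d. has_dir_deriv \<theta> x v d)"

definition has_gateaux_deriv ::
    "('z::real_normed_vector \<Rightarrow> real) \<Rightarrow> ('z \<Rightarrow>\<^sub>L real) \<Rightarrow> 'z \<Rightarrow> bool" where
  "has_gateaux_deriv \<theta> L x \<longleftrightarrow> (\<forall>v. has_dir_deriv \<theta> x v (blinfun_apply L v))"

definition gateaux_differentiable :: "('z::real_normed_vector \<Rightarrow> real) \<Rightarrow> 'z \<Rightarrow> bool" where
  "gateaux_differentiable \<theta> x \<longleftrightarrow> (\<exists>L. has_gateaux_deriv \<theta> L x)"

definition gateaux_deriv :: "('z::real_normed_vector \<Rightarrow> real) \<Rightarrow> 'z \<Rightarrow> ('z \<Rightarrow>\<^sub>L real)" where
  "gateaux_deriv \<theta> x = (THE L. has_gateaux_deriv \<theta> L x)"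

definition clarke_deriv :: "('z::real_normed_vector \<Rightarrow> real) \<Rightarrow> 'z \<Rightarrow> 'z \<Rightarrow> ereal" where
  "clarke_deriv \<theta> x v =
     Limsup (nhds x \<times>\<^sub>F at_right 0) (\<lambda>(y, t). ereal ((\<theta> (y + t *\<^sub>R v) - \<theta> y) / t))"

definition clarke_regular :: "('z::real_normed_vector \<Rightarrow> real) \<Rightarrow> 'z \<Rightarrow> bool" where
  "clarke_regular \<theta> x \<longleftrightarrow>
     (\<forall>v. \<exists>d. has_dir_deriv \<theta> x v d \<and> clarke_deriv \<theta> x v = ereal d)"

definition has_second_dir_deriv ::
    "('z::real_normed_vector \<Rightarrow> real) \<Rightarrow> 'z \<Rightarrow> 'z \<Rightarrow> real \<Rightarrow> bool" where
  "has_second_dir_deriv \<theta> x v d \<longleftrightarrow>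
     ((\<lambda>t. (\<theta> (x + t *\<^sub>R v) - \<theta> x - t * dir_deriv \<theta> x v) / (1 / 2 * t\<^sup>2)) \<longlongrightarrow> d) (at_right 0)"

definition second_dir_deriv :: "('z::real_normed_vector \<Rightarrow> real) \<Rightarrow> 'z \<Rightarrow> 'z \<Rightarrow> real" where
  "second_dir_deriv \<theta> x v = (THE d. has_second_dir_deriv \<theta> x v d)"

text \<open>The second-order upper directional derivative of Pales and Zeidan.\<close>

definition pz_deriv :: "('z::real_normed_vector \<Rightarrow> real) \<Rightarrow> 'z \<Rightarrow> 'z \<Rightarrow> ereal" where
  "pz_deriv \<theta> x v =
     Limsup (at_right 0) (\<lambda>t.
       (ereal (\<theta> (x + t *\<^sub>R v) - \<theta> x) - ereal t * clarke_deriv \<theta> x v) / ereal (1 / 2 * t\<^sup>2))"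


text \<open>A vector of length \<open>n\<close>, or a map into such vectors, is given by its components with indices
  in \<open>{1..n}\<close>; the values at other indices are irrelevant. This also covers \<open>m = 0\<close> and \<open>l = 0\<close>.\<close>

definition feasible_set ::
    "nat \<Rightarrow> nat \<Rightarrow> 'z set \<Rightarrow> (nat \<Rightarrow> 'z \<Rightarrow> real) \<Rightarrow> (nat \<Rightarrow> 'z \<Rightarrow> real) \<Rightarrow> 'z set" where
  "feasible_set m l U g h = {x \<in> U. (\<forall>j\<in>{1..m}. g j x \<le> 0) \<and> (\<forall>k\<in>{1..l}. h k x = 0)}"

definition contingent_cone :: "'z::real_normed_vector set \<Rightarrow> 'z \<Rightarrow> 'z set" where
  "contingent_cone X u =
     {d. \<exists>t :: nat \<Rightarrow> real. \<exists>e :: nat \<Rightarrow> 'z.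
           (\<forall>n. t n > 0) \<and> t \<longlonglongrightarrow> 0 \<and> e \<longlonglongrightarrow> d \<and> (\<forall>n. u + t n *\<^sub>R e n \<in> X)}"

definition active_set :: "nat \<Rightarrow> (nat \<Rightarrow> 'z \<Rightarrow> real) \<Rightarrow> 'z \<Rightarrow> nat set" where
  "active_set m g u = {j \<in> {1..m}. g j u = 0}"

definition linearized_cone ::
    "nat \<Rightarrow> nat \<Rightarrow> nat \<Rightarrow> (nat \<Rightarrow> 'z \<Rightarrow> real) \<Rightarrow> (nat \<Rightarrow> 'z \<Rightarrow> real) \<Rightarrow>
     (nat \<Rightarrow> 'z \<Rightarrow> real) \<Rightarrow> (nat \<Rightarrow> 'z \<Rightarrow> real) \<Rightarrow> 'z::real_normed_vector \<Rightarrow> 'z set" where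
  "linearized_cone p m l f F g h u =
     {d. (\<forall>i\<in>{1..p}. clarke_deriv (\<lambda>y. f i y / F i y) u d \<le> 0) \<and>
         (\<forall>j\<in>active_set m g u. clarke_deriv (g j) u d \<le> 0) \<and>
         (\<forall>k\<in>{1..l}. clarke_deriv (h k) u d = 0)}"

definition critical_directions ::
    "nat \<Rightarrow> nat \<Rightarrow> nat \<Rightarrow> 'z set \<Rightarrow> (nat \<Rightarrow> 'z \<Rightarrow> real) \<Rightarrow> (nat \<Rightarrow> 'z \<Rightarrow> real) \<Rightarrow>
     (nat \<Rightarrow> 'z \<Rightarrow> real) \<Rightarrow> (nat \<Rightarrow> 'z \<Rightarrow> real) \<Rightarrow> 'z::real_normed_vector \<Rightarrow> 'z set" where
  "critical_directions p m l U f F g h u =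
     contingent_cone (feasible_set m l U g h) u \<inter> linearized_cone p m l f F g h u"

text \<open>The feasible set of the Mond--Weir-type second-order dual. The second-order condition is
  stated in the extended reals; it is only meaningful when all the second-order derivatives that
  occur in it are finite, and then it is an inequality between real numbers.\<close>

definition mwsd_feasible_set ::
    "nat \<Rightarrow> nat \<Rightarrow> nat \<Rightarrow> 'z set \<Rightarrow> (nat \<Rightarrow> 'z \<Rightarrow> real) \<Rightarrow> (nat \<Rightarrow> 'z \<Rightarrow> real) \<Rightarrow>
     (nat \<Rightarrow> 'z \<Rightarrow> real) \<Rightarrow> (nat \<Rightarrow> 'z \<Rightarrow> real) \<Rightarrow>
     ('z::real_normed_vector \<times> (nat \<Rightarrow> real) \<times> (nat \<Rightarrow> real) \<times> (nat \<Rightarrow> real)) set" where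
  "mwsd_feasible_set p m l U f F g h =
     {(u, lam, mu, nu).
        u \<in> U \<and> (\<forall>i\<in>{1..p}. lam i > 0) \<and> (\<forall>j\<in>{1..m}. mu j \<ge> 0) \<and>
        (let s = (\<lambda>i. f i u / F i u) in
          (\<Sum>i\<in>{1..p}. lam i *\<^sub>R (gateaux_deriv (f i) u - s i *\<^sub>R gateaux_deriv (F i) u))
            + (\<Sum>j\<in>{1..m}. mu j *\<^sub>R gateaux_deriv (g j) u)
            + (\<Sum>k\<in>{1..l}. nu k *\<^sub>R gateaux_deriv (h k) u) = 0 \<and>
          (\<forall>v\<in>critical_directions p m l U f F g h u.
            (\<Sum>i\<in>{1..p}. ereal (lam i) *
                (pz_deriv (f i) u v - ereal (s i * second_dir_deriv (F i) u v)))
              + (\<Sum>j\<in>{1..m}. ereal (mu j) * pz_deriv (g j) u v)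
              + (\<Sum>k\<in>{1..l}. ereal (nu k) * pz_deriv (h k) u v) \<ge> 0)) \<and>
        (\<Sum>j\<in>{1..m}. mu j * g j u) + (\<Sum>k\<in>{1..l}. nu k * h k u) \<ge> 0 \<and>
        (\<Sum>i\<in>{1..p}. lam i) = 1}"

text \<open>Second-order convexity of \<open>a\<close> and \<open>g\<close> and second-order infineness of \<open>h\<close> at \<open>u\<close>, with
  directions \<open>v\<close> and \<open>w\<close> common to all components.\<close>

definition second_order_convex_infine ::
    "nat \<Rightarrow> nat \<Rightarrow> nat \<Rightarrow> 'z set \<Rightarrow> 'z set \<Rightarrow> (nat \<Rightarrow> 'z \<Rightarrow> real) \<Rightarrow>
     (nat \<Rightarrow> 'z \<Rightarrow> real) \<Rightarrow> (nat \<Rightarrow> 'z \<Rightarrow> real) \<Rightarrow> 'z::real_normed_vector \<Rightarrow> bool" where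
  "second_order_convex_infine p m l U D a g h u \<longleftrightarrow>
     (\<forall>y\<in>U. \<exists>v\<in>D - {0}. \<exists>w\<in>UNIV - {0}.
        (\<forall>i\<in>{1..p}. ereal (a i y - a i u) \<ge>
            clarke_deriv (a i) u w + ereal (1 / 2) * pz_deriv (a i) u v) \<and>
        (\<forall>j\<in>{1..m}. ereal (g j y - g j u) \<ge>
            clarke_deriv (g j) u w + ereal (1 / 2) * pz_deriv (g j) u v) \<and>
        (\<forall>k\<in>{1..l}. ereal (h k y - h k u) =
            clarke_deriv (h k) u w + ereal (1 / 2) * pz_deriv (h k) u v))"

end

theory Submission
  imports Defs
begin

text \<open>Clarke regularity together with linearity of the Gateaux derivative forces the difference
  quotient to converge jointly in base point and step size, so sums and multiples of such functions
  obey exact calculus rules for \<open>clarke_deriv\<close>, whatever the signs of the coefficients. This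
  gives the needed lower bound on the second-order derivative of \<open>f\<^sub>i - s\<^sub>i F\<^sub>i\<close>. Pairing
  the convexity inequalities at \<open>x\<close> with the multipliers then makes the first-order terms vanish and
  the second-order terms nonnegative, so \<open>\<Sum>\<^sub>i \<lambda>\<^sub>i (f\<^sub>i - s\<^sub>i F\<^sub>i)(x) \<ge> 0\<close>, which excludes
  that \<open>x\<close> dominates \<open>u\<close>.\<close>

text \<open>Upper limits are in general only subadditive; convergence of one summand supplies the
  reverse bound. Eventually \<open>B t\<close> exceeds \<open>b - e\<close>, a finite constant
  passes through \<open>Limsup\<close>, and \<open>e\<close> is arbitrary. The upper limit of
  \<open>A\<close> may be infinite.\<close>

lemma Limsup_add_tendsto_ge:
  fixes A B :: "'a \<Rightarrow> real"
  assumes "F \<noteq> bot" and B: "(B \<longlongrightarrow> b) F"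
  shows "Limsup F (\<lambda>t. ereal (A t)) + ereal b \<le> Limsup F (\<lambda>t. ereal (A t + B t))"
proof (rule ereal_le_epsilon2)
  fix e :: real
  assume "0 < e"
  then have "\<forall>\<^sub>F t in F. b - e < B t"
    using B by (intro order_tendstoD(1)[OF B]) simp
  then have "Limsup F (\<lambda>t. ereal (A t) + ereal (b - e)) \<le> Limsup F (\<lambda>t. ereal (A t + B t))"
    by (intro Limsup_mono) (auto elim!: eventually_mono)
  then have "Limsup F (\<lambda>t. ereal (A t)) + ereal (b - e) \<le> Limsup F (\<lambda>t. ereal (A t + B t))"
    using Limsup_add_ereal_right[OF \<open>F \<noteq> bot\<close>, of "ereal (b - e)" "\<lambda>t. ereal (A t)"] by simp
  then show "Limsup F (\<lambda>t. ereal (A t)) + ereal b \<le> Limsup F (\<lambda>t. ereal (A t + B t)) + ereal e"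
    by (cases "Limsup F (\<lambda>t. ereal (A t))"; cases "Limsup F (\<lambda>t. ereal (A t + B t))") auto
qed

lemma has_dir_deriv_unique:
  "has_dir_deriv \<theta> x v d \<Longrightarrow> has_dir_deriv \<theta> x v d' \<Longrightarrow> d = d'"
  unfolding has_dir_deriv_def by (rule tendsto_unique[OF trivial_limit_at_right_real])

lemma dir_deriv_eqI: "has_dir_deriv \<theta> x v d \<Longrightarrow> dir_deriv \<theta> x v = d"
  unfolding dir_deriv_def by (blast intro: has_dir_deriv_unique)

lemma has_gateaux_deriv_gateaux_deriv:
  assumes "gateaux_differentiable \<theta> x"
  shows "has_gateaux_deriv \<theta> (gateaux_deriv \<theta> x) x"
proof -
  obtain L where L: "has_gateaux_deriv \<theta> L x"
    using assms unfolding gateaux_differentiable_def by blast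
  show ?thesis
    unfolding gateaux_deriv_def
  proof (rule theI[where P = "\<lambda>L. has_gateaux_deriv \<theta> L x", OF L])
    show "L' = L" if "has_gateaux_deriv \<theta> L' x" for L'
      using that L unfolding has_gateaux_deriv_def
      by (intro blinfun_eqI) (blast intro: has_dir_deriv_unique)
  qed
qed

lemma second_dir_deriv_eqI:
  "has_second_dir_deriv \<theta> x v d \<Longrightarrow> second_dir_deriv \<theta> x v = d"
  unfolding second_dir_deriv_def has_second_dir_deriv_def
  by (blast intro: tendsto_unique[OF trivial_limit_at_right_real])

text \<open>Regularity identifies the Clarke derivative with the one-sided directional derivative,
  and Gateaux differentiability makes the latter a value of a linear functional.\<close>

lemma clarke_regular_deriv_eq:
  assumes "clarke_regular \<theta> x" and "gateaux_differentiable \<theta> x"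
  shows "clarke_deriv \<theta> x v = ereal (gateaux_deriv \<theta> x v)"
  using assms has_gateaux_deriv_gateaux_deriv[OF assms(2)]
  unfolding clarke_regular_def has_gateaux_deriv_def by (metis has_dir_deriv_unique)

text \<open>The lower bound comes from the upper limit in the direction \<open>-v\<close>, taken at the shifted base
  point \<open>y + t v\<close>.\<close>

lemma clarke_regular_strictly_differentiable:
  assumes "clarke_regular \<theta> x" and "gateaux_differentiable \<theta> x"
  shows "((\<lambda>(y, t). (\<theta> (y + t *\<^sub>R v) - \<theta> y) / t) \<longlongrightarrow> gateaux_deriv \<theta> x v)
           (nhds x \<times>\<^sub>F at_right 0)"
proof (rule order_tendstoI)
  let ?N = "nhds x \<times>\<^sub>F at_right (0::real)"
  have below: "\<forall>\<^sub>F (y, t) in ?N. (\<theta> (y + t *\<^sub>R w) - \<theta> y) / t < a"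
    if "gateaux_deriv \<theta> x w < a" for a w
  proof -
    have "clarke_deriv \<theta> x w < ereal a"
      using that clarke_regular_deriv_eq[OF assms] by simp
    then show ?thesis
      unfolding clarke_deriv_def by (drule_tac Limsup_lessD) (simp add: case_prod_unfold)
  qed
  show "\<forall>\<^sub>F z in ?N. (case z of (y, t) \<Rightarrow> (\<theta> (y + t *\<^sub>R v) - \<theta> y) / t) < a"
    if "gateaux_deriv \<theta> x v < a" for a
    using below[OF that] by (simp add: case_prod_unfold)
  show "\<forall>\<^sub>F z in ?N. a < (case z of (y, t) \<Rightarrow> (\<theta> (y + t *\<^sub>R v) - \<theta> y) / t)"
    if "a < gateaux_deriv \<theta> x v" for a
  proof -
    have snd0: "(snd \<longlongrightarrow> 0) ?N"
      by (rule filterlim_mono[OF filterlim_snd _ order_refl]) (simp add: at_within_le_nhds)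
    have "((\<lambda>z. fst z + snd z *\<^sub>R v) \<longlongrightarrow> x + 0 *\<^sub>R v) ?N"
      by (intro tendsto_add tendsto_scaleR snd0 tendsto_const filterlim_fst)
    \<comment> \<open>Since \<open>y + t v\<close> tends to \<open>x\<close> along the product
      filter, moving the base point while keeping the step size preserves that filter.\<close>
    then have shift: "filterlim (\<lambda>z. (fst z + snd z *\<^sub>R v, snd z)) ?N ?N"
      by (intro filterlim_Pair filterlim_snd) simp
    have "gateaux_deriv \<theta> x (- v) < - a"
      using that by (simp add: blinfun.minus_right)
    \<comment> \<open>The quotient in direction \<open>- v\<close> at base point
      \<open>y + t v\<close> is exactly the negative of the quotient in direction \<open>v\<close>
      at \<open>y\<close>, so an upper bound on the former is a lower bound on the latter.\<close>
    from eventually_compose_filterlim[OF below[OF this] shift] show ?thesis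
      by (rule eventually_mono) (auto simp: minus_divide_left[symmetric] diff_divide_distrib)
  qed
qed

text \<open>Both joint difference quotients converge, so their combination converges and its upper
  limit is the limit. The sign of \<open>c\<close> is free, as required for \<open>s i\<close>,
  since \<open>f i u\<close> may be negative.\<close>

lemma clarke_deriv_diff_cmult:
  fixes \<phi> \<psi> :: "'z::real_normed_vector \<Rightarrow> real"
  assumes \<phi>: "clarke_regular \<phi> x" "gateaux_differentiable \<phi> x"
    and \<psi>: "clarke_regular \<psi> x" "gateaux_differentiable \<psi> x"
  shows "clarke_deriv (\<lambda>y. \<phi> y - c * \<psi> y) x v =
           ereal (gateaux_deriv \<phi> x v - c * gateaux_deriv \<psi> x v)"
proof -
  let ?N = "nhds x \<times>\<^sub>F at_right (0::real)"
  have "((\<lambda>z. (case z of (y, t) \<Rightarrow> (\<phi> (y + t *\<^sub>R v) - \<phi> y) / t)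
            - c * (case z of (y, t) \<Rightarrow> (\<psi> (y + t *\<^sub>R v) - \<psi> y) / t))
          \<longlongrightarrow> gateaux_deriv \<phi> x v - c * gateaux_deriv \<psi> x v) ?N"
    by (intro tendsto_diff tendsto_mult tendsto_const clarke_regular_strictly_differentiable assms)
  moreover have "(\<lambda>z. (case z of (y, t) \<Rightarrow> (\<phi> (y + t *\<^sub>R v) - \<phi> y) / t)
            - c * (case z of (y, t) \<Rightarrow> (\<psi> (y + t *\<^sub>R v) - \<psi> y) / t)) =
        (\<lambda>(y, t). ((\<phi> (y + t *\<^sub>R v) - c * \<psi> (y + t *\<^sub>R v)) - (\<phi> y - c * \<psi> y)) / t)"
    by (auto simp: fun_eq_iff diff_divide_distrib right_diff_distrib)
  ultimately have "((\<lambda>(y, t). ereal (((\<phi> (y + t *\<^sub>R v) - c * \<psi> (y + t *\<^sub>R v)) -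
          (\<phi> y - c * \<psi> y)) / t))
        \<longlongrightarrow> ereal (gateaux_deriv \<phi> x v - c * gateaux_deriv \<psi> x v)) ?N"
    by (simp add: case_prod_unfold)
  moreover have "?N \<noteq> bot"
    by (simp add: prod_filter_eq_bot)
  ultimately show ?thesis
    unfolding clarke_deriv_def by (rule lim_imp_Limsup[rotated])
qed

text \<open>A finite Clarke derivative turns the extended-real quotient into a real one at every
  \<open>t > 0\<close>, where the denominator is nonzero.\<close>

lemma pz_deriv_real:
  assumes "clarke_deriv \<theta> x v = ereal c"
  shows "pz_deriv \<theta> x v =
           Limsup (at_right 0) (\<lambda>t. ereal ((\<theta> (x + t *\<^sub>R v) - \<theta> x - t * c) / (1 / 2 * t\<^sup>2)))"
  unfolding pz_deriv_def assms
  by (rule Limsup_eq, rule eventually_mono[OF eventually_at_right_less[of 0]]) auto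

text \<open>Convexity concerns the second-order derivative of the combination, the dual constraint
  those of \<open>f i\<close> and \<open>F i\<close> separately; this inequality links them. The
  second-order quotients combine linearly because the first-order terms do, and that of \<psi> has a
  genuine limit.\<close>

lemma pz_deriv_diff_cmult_ge:
  fixes \<phi> \<psi> :: "'z::real_normed_vector \<Rightarrow> real"
  assumes \<phi>: "clarke_regular \<phi> x" "gateaux_differentiable \<phi> x"
    and \<psi>: "clarke_regular \<psi> x" "gateaux_differentiable \<psi> x"
    and d: "has_second_dir_deriv \<psi> x v d"
  shows "pz_deriv \<phi> x v - ereal (c * d) \<le> pz_deriv (\<lambda>y. \<phi> y - c * \<psi> y) x v"
proof -
  let ?a = "gateaux_deriv \<phi> x v" and ?b = "gateaux_deriv \<psi> x v"
  define A where "A t = (\<phi> (x + t *\<^sub>R v) - \<phi> x - t * ?a) / (1 / 2 * t\<^sup>2)" for t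
  define B where "B t = (\<psi> (x + t *\<^sub>R v) - \<psi> x - t * ?b) / (1 / 2 * t\<^sup>2)" for t
  have "dir_deriv \<psi> x v = ?b"
    using has_gateaux_deriv_gateaux_deriv[OF \<psi>(2)] unfolding has_gateaux_deriv_def
    by (blast intro: dir_deriv_eqI)
  then have "(B \<longlongrightarrow> d) (at_right 0)"
    using d unfolding has_second_dir_deriv_def B_def by simp
  then have B: "((\<lambda>t. - c * B t) \<longlongrightarrow> - c * d) (at_right 0)"
    by (intro tendsto_intros)
  have "pz_deriv \<phi> x v - ereal (c * d) = Limsup (at_right 0) (\<lambda>t. ereal (A t)) + ereal (- c * d)"
    unfolding A_def pz_deriv_real[OF clarke_regular_deriv_eq[OF \<phi>], symmetric]
    by (simp add: minus_ereal_def)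
  also have "\<dots> \<le> Limsup (at_right 0) (\<lambda>t. ereal (A t + - c * B t))"
    by (rule Limsup_add_tendsto_ge[OF trivial_limit_at_right_real B])
  also have "(\<lambda>t. A t + - c * B t) = (\<lambda>t. ((\<phi> (x + t *\<^sub>R v) - c * \<psi> (x + t *\<^sub>R v)) -
      (\<phi> x - c * \<psi> x) - t * (?a - c * ?b)) / (1 / 2 * t\<^sup>2))"
    by (simp add: A_def B_def fun_eq_iff algebra_simps add_divide_distrib diff_divide_distrib)
  also have "Limsup (at_right 0) (\<lambda>t. ereal (\<dots> t)) = pz_deriv (\<lambda>y. \<phi> y - c * \<psi> y) x v"
    by (rule pz_deriv_real[OF clarke_deriv_diff_cmult[OF \<phi> \<psi>], symmetric])
  finally show ?thesis .
qed

theorem theorem5p1: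
  fixes U :: "'z::banach set"
    and f F g h :: "nat \<Rightarrow> 'z \<Rightarrow> real"
    and p m l :: nat
    and x u :: 'z
    and lam mu nu s :: "nat \<Rightarrow> real"
  assumes "reflexive_space TYPE('z)"
    and "open U" and "U \<noteq> {}"
    and "\<And>i y. i \<in> {1..p} \<Longrightarrow> y \<in> U \<Longrightarrow> F i y > 0"
    and "\<And>i. i \<in> {1..p} \<Longrightarrow> locally_lipschitz_on U (f i)"
    and "\<And>i. i \<in> {1..p} \<Longrightarrow> locally_lipschitz_on U (F i)"
    and "\<And>j. j \<in> {1..m} \<Longrightarrow> locally_lipschitz_on U (g j)"
    and "\<And>k. k \<in> {1..l} \<Longrightarrow> locally_lipschitz_on U (h k)"
    and "\<And>i y. i \<in> {1..p} \<Longrightarrow> y \<in> U \<Longrightarrow> gateaux_differentiable (f i) y \<and> clarke_regular (f i) y"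
    and "\<And>i y. i \<in> {1..p} \<Longrightarrow> y \<in> U \<Longrightarrow> gateaux_differentiable (F i) y \<and> clarke_regular (F i) y"
    and "\<And>j y. j \<in> {1..m} \<Longrightarrow> y \<in> U \<Longrightarrow> gateaux_differentiable (g j) y \<and> clarke_regular (g j) y"
    and "\<And>k y. k \<in> {1..l} \<Longrightarrow> y \<in> U \<Longrightarrow> gateaux_differentiable (h k) y \<and> clarke_regular (h k) y"
    and "\<And>i y d. i \<in> {1..p} \<Longrightarrow> y \<in> U \<Longrightarrow> \<bar>pz_deriv (f i) y d\<bar> \<noteq> \<infinity>"
    and "\<And>j y d. j \<in> {1..m} \<Longrightarrow> y \<in> U \<Longrightarrow> \<bar>pz_deriv (g j) y d\<bar> \<noteq> \<infinity>"
    and "\<And>k y d. k \<in> {1..l} \<Longrightarrow> y \<in> U \<Longrightarrow> \<bar>pz_deriv (h k) y d\<bar> \<noteq> \<infinity>"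
    and "\<And>i y d. i \<in> {1..p} \<Longrightarrow> y \<in> U \<Longrightarrow> \<exists>r. has_second_dir_deriv (F i) y d r"
    and "x \<in> feasible_set m l U g h"
    and "(u, lam, mu, nu) \<in> mwsd_feasible_set p m l U f F g h"
    and "\<And>i. i \<in> {1..p} \<Longrightarrow> s i = f i u / F i u"
    and "second_order_convex_infine p m l U (critical_directions p m l U f F g h u)
           (\<lambda>i y. f i y - s i * F i y) g h u"
  shows "\<not> ((\<forall>i\<in>{1..p}. f i x / F i x \<le> f i u / F i u) \<and>
            (\<exists>i\<in>{1..p}. f i x / F i x < f i u / F i u))"
proof
  \<comment> \<open>Parametric form of the ratio: \<open>a i u = 0\<close>, and where
    \<open>F i\<close> is positive the sign of \<open>a i y\<close> tells how
    \<open>f i y / F i y\<close> compares with \<open>s i\<close>.\<close>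
  define a where "a i y = f i y - s i * F i y" for i y
  have uU: "u \<in> U"
    and lam: "\<And>i. i \<in> {1..p} \<Longrightarrow> lam i > 0"
    and mu: "\<And>j. j \<in> {1..m} \<Longrightarrow> mu j \<ge> 0"
    and stat: "(\<Sum>i\<in>{1..p}. lam i *\<^sub>R (gateaux_deriv (f i) u -
          (f i u / F i u) *\<^sub>R gateaux_deriv (F i) u))
        + (\<Sum>j\<in>{1..m}. mu j *\<^sub>R gateaux_deriv (g j) u)
        + (\<Sum>k\<in>{1..l}. nu k *\<^sub>R gateaux_deriv (h k) u) = 0"
    and second: "\<And>v. v \<in> critical_directions p m l U f F g h u \<Longrightarrow>
        (\<Sum>i\<in>{1..p}. ereal (lam i) *
            (pz_deriv (f i) u v - ereal (f i u / F i u * second_dir_deriv (F i) u v)))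
          + (\<Sum>j\<in>{1..m}. ereal (mu j) * pz_deriv (g j) u v)
          + (\<Sum>k\<in>{1..l}. ereal (nu k) * pz_deriv (h k) u v) \<ge> 0"
    and compl: "(\<Sum>j\<in>{1..m}. mu j * g j u) + (\<Sum>k\<in>{1..l}. nu k * h k u) \<ge> 0"
    using assms(18) unfolding mwsd_feasible_set_def Let_def by auto
  have xU: "x \<in> U" and gx: "\<And>j. j \<in> {1..m} \<Longrightarrow> g j x \<le> 0"
    and hx: "\<And>k. k \<in> {1..l} \<Longrightarrow> h k x = 0"
    using assms(17) unfolding feasible_set_def by auto
  \<comment> \<open>The convexity and infineness conditions are used at the single point
    \<open>x\<close>. Common directions allow the inequalities to be summed, and \<open>v\<close> is
    a direction at which the dual second-order condition holds.\<close>
  obtain v w where v: "v \<in> critical_directions p m l U f F g h u"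
    and a_conv: "\<And>i. i \<in> {1..p} \<Longrightarrow> ereal (a i x - a i u) \<ge>
        clarke_deriv (a i) u w + ereal (1 / 2) * pz_deriv (a i) u v"
    and g_conv: "\<And>j. j \<in> {1..m} \<Longrightarrow> ereal (g j x - g j u) \<ge>
        clarke_deriv (g j) u w + ereal (1 / 2) * pz_deriv (g j) u v"
    and h_inf: "\<And>k. k \<in> {1..l} \<Longrightarrow> ereal (h k x - h k u) =
        clarke_deriv (h k) u w + ereal (1 / 2) * pz_deriv (h k) u v"
    using assms(20) xU unfolding second_order_convex_infine_def a_def by blast
  define pf where "pf i = real_of_ereal (pz_deriv (f i) u v)" for i
  define pg where "pg j = real_of_ereal (pz_deriv (g j) u v)" for j
  define ph where "ph k = real_of_ereal (pz_deriv (h k) u v)" for k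
  define F2 where "F2 i = second_dir_deriv (F i) u v" for i
  define P where "P i = pf i - s i * F2 i" for i
  define La where "La i = gateaux_deriv (f i) u w - s i * gateaux_deriv (F i) u w" for i
  define Lg where "Lg j = gateaux_deriv (g j) u w" for j
  define Lh where "Lh k = gateaux_deriv (h k) u w" for k
  have pf: "pz_deriv (f i) u v = ereal (pf i)" if "i \<in> {1..p}" for i
    using assms(13)[OF that uU] by (simp add: pf_def ereal_real)
  have pg: "pz_deriv (g j) u v = ereal (pg j)" if "j \<in> {1..m}" for j
    using assms(14)[OF that uU] by (simp add: pg_def ereal_real)
  have ph: "pz_deriv (h k) u v = ereal (ph k)" if "k \<in> {1..l}" for k
    using assms(15)[OF that uU] by (simp add: ph_def ereal_real)

  have a_x: "a i x \<ge> La i + P i / 2" if i: "i \<in> {1..p}" for i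
  proof -
    have fF: "clarke_regular (f i) u" "gateaux_differentiable (f i) u"
        "clarke_regular (F i) u" "gateaux_differentiable (F i) u"
      using assms(9,10)[OF i uU] by auto
    have F2: "has_second_dir_deriv (F i) u v (F2 i)"
      using assms(16)[OF i uU] unfolding F2_def by (metis second_dir_deriv_eqI)
    have "ereal (P i) \<le> pz_deriv (a i) u v"
      using pz_deriv_diff_cmult_ge[OF fF F2, of "s i"] pf[OF i] by (simp add: P_def a_def[abs_def])
    \<comment> \<open>The comparison stays in the extended reals because
      \<open>pz_deriv (a i) u v\<close> has not been shown to be finite; only the two ends of the
      chain are real.\<close>
    then have "ereal (La i) + ereal (1 / 2) * ereal (P i)
        \<le> ereal (La i) + ereal (1 / 2) * pz_deriv (a i) u v"
      by (intro add_left_mono ereal_mult_left_mono) auto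
    also have "\<dots> \<le> ereal (a i x - a i u)"
      using a_conv[OF i] clarke_deriv_diff_cmult[OF fF, of "s i"]
      by (simp add: La_def a_def[abs_def])
    also have "a i u = 0"
      using assms(4)[OF i uU] by (simp add: a_def assms(19)[OF i])
    finally show ?thesis by simp
  qed
  have g_x: "g j x - g j u \<ge> Lg j + pg j / 2" if j: "j \<in> {1..m}" for j
    using g_conv[OF j] assms(11)[OF j uU] by (simp add: pg[OF j] clarke_regular_deriv_eq Lg_def)
  have h_x: "h k x - h k u = Lh k + ph k / 2" if k: "k \<in> {1..l}" for k
    using h_inf[OF k] assms(12)[OF k uU] by (simp add: ph[OF k] clarke_regular_deriv_eq Lh_def)

  \<comment> \<open>Stationarity, an identity between functionals, is evaluated at
    \<open>w\<close>.\<close>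
  have first0: "(\<Sum>i\<in>{1..p}. lam i * La i) + (\<Sum>j\<in>{1..m}. mu j * Lg j)
      + (\<Sum>k\<in>{1..l}. nu k * Lh k) = 0"
  proof -
    have "(\<Sum>i\<in>{1..p}. lam i * La i) =
        (\<Sum>i\<in>{1..p}. lam i * (gateaux_deriv (f i) u w - f i u / F i u * gateaux_deriv (F i) u w))"
      by (intro sum.cong) (simp_all add: La_def assms(19))
    then show ?thesis
      using arg_cong[OF stat, of "\<lambda>L. blinfun_apply L w"]
      by (simp add: Lg_def Lh_def blinfun.sum_left blinfun.add_left blinfun.diff_left
          blinfun.scaleR_left)
  qed
  \<comment> \<open>The dual second-order condition at \<open>v\<close>; finiteness of all its terms
    lets it be read in the reals.\<close>
  have second0: "(\<Sum>i\<in>{1..p}. lam i * P i) + (\<Sum>j\<in>{1..m}. mu j * pg j)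
      + (\<Sum>k\<in>{1..l}. nu k * ph k) \<ge> 0"
  proof -
    have "(\<Sum>i\<in>{1..p}. ereal (lam i) *
        (pz_deriv (f i) u v - ereal (f i u / F i u * second_dir_deriv (F i) u v)))
        = (\<Sum>i\<in>{1..p}. ereal (lam i * P i))"
      by (intro sum.cong) (simp_all add: P_def pf F2_def assms(19))
    moreover have "(\<Sum>j\<in>{1..m}. ereal (mu j) * pz_deriv (g j) u v) = (\<Sum>j\<in>{1..m}. ereal (mu j * pg j))"
      by (intro sum.cong) (simp_all add: pg)
    moreover have "(\<Sum>k\<in>{1..l}. ereal (nu k) * pz_deriv (h k) u v) = (\<Sum>k\<in>{1..l}. ereal (nu k * ph k))"
      by (intro sum.cong) (simp_all add: ph)
    ultimately show ?thesis
      using second[OF v] by simp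
  qed

  \<comment> \<open>The signs of \<open>lam\<close> and \<open>mu\<close> preserve the inequalities
    under weighting. The \<open>nu k\<close> have no sign, which is why \<open>h\<close> must
    satisfy an equality.\<close>
  have "(\<Sum>i\<in>{1..p}. lam i * (La i + P i / 2)) \<le> (\<Sum>i\<in>{1..p}. lam i * a i x)"
    using a_x lam by (intro sum_mono mult_left_mono) (auto intro: less_imp_le)
  moreover have "(\<Sum>j\<in>{1..m}. mu j * (Lg j + pg j / 2)) \<le> (\<Sum>j\<in>{1..m}. mu j * (g j x - g j u))"
    using g_x mu by (intro sum_mono mult_left_mono) auto
  moreover have "(\<Sum>j\<in>{1..m}. mu j * g j x) \<le> 0"
    using gx mu by (intro sum_nonpos) (simp add: mult_nonneg_nonpos)
  moreover have "(\<Sum>k\<in>{1..l}. nu k * (Lh k + ph k / 2)) = (\<Sum>k\<in>{1..l}. - (nu k * h k u))"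
    using h_x hx by (intro sum.cong) (auto simp flip: h_x)
  \<comment> \<open>By \<open>first0\<close> and half of \<open>second0\<close>, the weighted lower
    bounds for \<open>a\<close>, \<open>g\<close> and \<open>h\<close> sum to a nonnegative number.
    Hence the sum of \<open>lam i * a i x\<close> is at least minus the sum of
    \<open>mu j * g j x\<close> plus the left side of \<open>compl\<close>, and both contributions
    are nonnegative.\<close>
  ultimately have nonneg: "0 \<le> (\<Sum>i\<in>{1..p}. lam i * a i x)"
    using first0 second0 compl
    by (simp add: distrib_left right_diff_distrib sum.distrib sum_subtractf sum_negf
        flip: sum_divide_distrib)

  assume dom: "(\<forall>i\<in>{1..p}. f i x / F i x \<le> f i u / F i u) \<and>
    (\<exists>i\<in>{1..p}. f i x / F i x < f i u / F i u)"
  \<comment> \<open>Multiplying the ratio inequality by \<open>F i x > 0\<close> turns dominance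
    into a sign condition on \<open>a i x\<close>, strict at one index; positivity of every
    \<open>lam i\<close> keeps that strictness in the weighted sum.\<close>
  have "a i x \<le> 0" if i: "i \<in> {1..p}" for i
    using dom i pos_divide_le_eq[OF assms(4)[OF i xU], of "f i x" "s i"]
    by (simp add: a_def assms(19))
  moreover obtain i where i: "i \<in> {1..p}" and "f i x / F i x < f i u / F i u"
    using dom by blast
  then have "a i x < 0"
    using pos_divide_less_eq[OF assms(4)[OF i xU], of "f i x" "s i"]
    by (simp add: a_def assms(19))
  ultimately have "(\<Sum>i\<in>{1..p}. lam i * a i x) < (\<Sum>i\<in>{1..p}. 0)"
    using lam i
    by (intro sum_strict_mono_ex1) (auto intro!: mult_nonneg_nonpos bexI[of _ i] mult_pos_neg intro: less_imp_le)
  with nonneg show False by simp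
qed

end
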